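(* Let $(G_j)_{j\in\mathbb Z}$ be a generalized Fibonacci sequence. If $n$ and $t$ are integers, then $$\sum_{j=1}^n(-1)^{j-1}G_{j+t}^5\,(G_{j+t+1}+G_{j+t-1})=\frac{(-1)^{n+1}}{2}\,G_{n+t}^2G_{n+t+1}^2G_{n+t+2}^2+\frac12\,G_t^2G_{t+1}^2G_{t+2}^2+(-1)^nG_{n+t+1}^4G_{n+t}^2-G_{t+1}^4G_t^2.$$
   Context: A generalized Fibonacci sequence $(G_j)_{j\in\mathbb Z}$ is a sequence with arbitrary initial numbers $G_0,G_1$ (say complex; usually integers), not both zero, satisfying $G_j=G_{j-1}+G_{j-2}$ for $j\ge 2$, and extended to negative indices by $G_{-j}=G_{-(j-2)}-G_{-(j-1)}$ for $j\ge1$, so that the recurrence holds for all integer indices. For $n=0$ the sum $\sum_{j=1}^n a_j$ is $0$, and for $n<0$ it is understood as $\sum_{j=1}^n a_j=-\sum_{j=n+1}^{0}a_j$. *)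

theory Defs
  imports Complex_Main
begin

definition gen_fib :: "(int \<Rightarrow> complex) \<Rightarrow> bool" where
  "gen_fib G \<longleftrightarrow>
     (G 0 \<noteq> 0 \<or> G 1 \<noteq> 0) \<and>
     (\<forall>j\<ge>2. G j = G (j - 1) + G (j - 2)) \<and>
     (\<forall>j\<ge>1. G (- j) = G (- (j - 2)) - G (- (j - 1)))"

text \<open>The sum of \<open>f j\<close> for \<open>j\<close> from 1 to \<open>n\<close>, for an arbitrary integer upper limit;
  unlike \<open>sum f {1..n}\<close>, it does not vanish identically for negative \<open>n\<close>.\<close>

definition signed_sum :: "(int \<Rightarrow> 'a::ab_group_add) \<Rightarrow> int \<Rightarrow> 'a" where
  "signed_sum f n = (if n \<ge> 0 then (\<Sum>j=1..n. f j) else - (\<Sum>j=n+1..0. f j))"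

end

theory Submission
  imports Defs
begin

text \<open>The identity is a telescoping sum. Write \<open>a = G m\<close>, \<open>b = G (m + 1)\<close>, so that
  \<open>G (m + 2) = a + b\<close> and \<open>G (m - 1) = b - a\<close>, and put
  \<open>P(a, b) = b\<^sup>4 a\<^sup>2 - a\<^sup>2 b\<^sup>2 (a + b)\<^sup>2 / 2\<close>. The right-hand side is \<open>F n - F 0\<close> for
  \<open>F j = (-1)\<^sup>j P(G (j + t), G (j + t + 1))\<close>. Since consecutive signs are opposite,
  \<open>F j - F (j - 1)\<close> is \<open>(-1)\<^sup>j\<close> times \<open>P(a, b) + P(b - a, a)\<close> with \<open>m = j + t\<close>. In this sum the
  terms of \<open>P\<close> with factor \<open>1/2\<close> combine, through
  \<open>(a + b)\<^sup>2 + (b - a)\<^sup>2 = 2 (a\<^sup>2 + b\<^sup>2)\<close>, to \<open>- a\<^sup>4 b\<^sup>2 - a\<^sup>2 b\<^sup>4\<close>; what survives is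
  \<open>a\<^sup>6 - 2 a\<^sup>5 b = - a\<^sup>5 (b + (b - a))\<close>, so that \<open>F j - F (j - 1)\<close> is the summand.\<close>

lemma gen_fib_rec:
  assumes "gen_fib G"
  shows "G (k + 2) = G (k + 1) + G k"
proof (cases "k \<ge> 0")
  case True
  then have "G (k + 2) = G (k + 2 - 1) + G (k + 2 - 2)"
    using assms unfolding gen_fib_def by simp
  then show ?thesis
    by (simp add: algebra_simps)
next
  case False
  then have "- k \<ge> 1"
    by simp
  then have "G (- (- k)) = G (- (- k - 2)) - G (- (- k - 1))"
    using assms unfolding gen_fib_def by blast
  then show ?thesis
    by (simp add: algebra_simps)
qed

text \<open>The sign convention for negative upper limits is exactly what makes telescoping
  insensitive to the sign of \<open>n\<close>.\<close>

lemma signed_sum_telescope: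
  assumes step: "\<And>j. f j = F j - F (j - 1)"
  shows "signed_sum f n = F n - F 0"
proof (cases "n \<ge> 0")
  case True
  then have "(\<Sum>j=1..n. f j) = F n - F 0"
  proof (induction n rule: int_ge_induct)
    case base
    show ?case by simp
  next
    case (step i)
    then have "{1..i + 1} = insert (i + 1) {1..i}" by auto
    with step show ?case by (simp add: assms)
  qed
  with True show ?thesis by (simp add: signed_sum_def)
next
  case False
  then have "n \<le> 0" by simp
  then have "(\<Sum>j=n+1..0. f j) = F 0 - F n"
  proof (induction n rule: int_le_induct)
    case base
    show ?case by simp
  next
    case (step i)
    then have "{i - 1 + 1..0} = insert i {i + 1..0}" by auto
    with step show ?case by (simp add: assms)
  qed
  with False show ?thesis by (simp add: signed_sum_def)
qed

theorem proposition5: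
  fixes G :: "int \<Rightarrow> complex" and n t :: int
  assumes "gen_fib G"
  shows "signed_sum (\<lambda>j. (-1) powi (j - 1) * G (j + t) ^ 5 * (G (j + t + 1) + G (j + t - 1))) n
    = (-1) powi (n + 1) / 2 * G (n + t) ^ 2 * G (n + t + 1) ^ 2 * G (n + t + 2) ^ 2
      + 1 / 2 * G t ^ 2 * G (t + 1) ^ 2 * G (t + 2) ^ 2
      + (-1) powi n * G (n + t + 1) ^ 4 * G (n + t) ^ 2
      - G (t + 1) ^ 4 * G t ^ 2"
proof -
  define F where "F j = (-1) powi j *
      (G (j + t + 1) ^ 4 * G (j + t) ^ 2
        - G (j + t) ^ 2 * G (j + t + 1) ^ 2 * G (j + t + 2) ^ 2 / 2)" for j
  have step: "(-1) powi (j - 1) * G (j + t) ^ 5 * (G (j + t + 1) + G (j + t - 1))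
      = F j - F (j - 1)" for j
  proof -
    define a b s where "a = G (j + t)" and "b = G (j + t + 1)" and "s = (-1 :: complex) powi j"
    have next_val: "G (j + t + 2) = a + b"
      using gen_fib_rec[OF assms, of "j + t"] by (simp add: a_def b_def)
    have prev_val: "G (j + t - 1) = b - a"
      using gen_fib_rec[OF assms, of "j + t - 1"] by (simp add: a_def b_def algebra_simps)
    have sign: "(-1 :: complex) powi (j - 1) = - s"
      by (simp add: s_def power_int_diff)
    have shift: "j - 1 + t = j + t - 1" "j + t - 1 + 1 = j + t" "j + t - 1 + 2 = j + t + 1"
      by simp_all
    have "- s * a ^ 5 * (b + (b - a))
        = s * (b ^ 4 * a ^ 2 - a ^ 2 * b ^ 2 * (a + b) ^ 2 / 2)
          - (- s) * (a ^ 4 * (b - a) ^ 2 - (b - a) ^ 2 * a ^ 2 * b ^ 2 / 2)"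
      by (simp add: field_simps eval_nat_numeral)
    then show ?thesis
      unfolding F_def shift sign next_val prev_val
      by (simp only: a_def b_def s_def)
  qed
  have "(-1 :: complex) powi (n + 1) = - ((-1) powi n)"
    by (simp add: power_int_add)
  then show ?thesis
    unfolding signed_sum_telescope[of _ F, OF step]
    by (simp add: F_def algebra_simps)
qed

end
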